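(* Let $m\ge0$ and let $\{X_i\}_{i\ge1}$ be a non-negative stationary $m$-dependent sequence with $\mu:=\mathbb{E}[X_1]>0$, $\sigma^2:=\mathrm{Var}(X_1)>0$, $\mathbb{E}|X_1|^3<\infty$, $a_j:=\mathrm{Cov}(X_1,X_{1+j})$ for $j=1,\dots,m$, and $\sigma^2+2\sum_{j=1}^m a_j>0$. Let $Y_1,Y_2,\dots$ be i.i.d. non-negative integer-valued random variables with $\nu:=\mathbb{E}[Y_1]>0$, $\tau^2:=\mathrm{Var}(Y_1)>0$, $\mathbb{E}|Y_1|^3<\infty$, independent of $\{X_i\}$, and let $N_n=\sum_{i=1}^nY_i$. Then $$\frac{\sum_{i=1}^{N_n}X_i-n\mu\nu}{\sqrt{n\big(\nu\sigma^2+2\nu\sum_{j=1}^m a_j+\tau^2\mu^2\big)}}\longrightarrow N(0,1)\quad\text{in distribution as } n\to\infty.$$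
   Context: Stationary: for all $k$, shifts $s\ge0$ and indices $i_1,\dots,i_k$, $(X_{i_1+s},\dots,X_{i_k+s})$ has the same joint law as $(X_{i_1},\dots,X_{i_k})$. $m$-dependent: with $\rho(A,B)=\inf\{|i-j|:i\in A,j\in B\}$ for $A,B\subset\mathbb{N}$, the families $\{X_i:i\in A\}$ and $\{X_j:j\in B\}$ are independent whenever $\rho(A,B)>m$. An empty sum equals $0$. $N(0,1)$ denotes a standard normal random variable. *)

theory Defs
  imports "HOL-Probability.Probability"
begin

definition cov :: "'a measure \<Rightarrow> ('a \<Rightarrow> real) \<Rightarrow> ('a \<Rightarrow> real) \<Rightarrow> real" where
  "cov M U V = (\<integral>\<omega>. (U \<omega> - (\<integral>x. U x \<partial>M)) * (V \<omega> - (\<integral>x. V x \<partial>M)) \<partial>M)"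

definition stationary_seq :: "'a measure \<Rightarrow> (nat \<Rightarrow> 'a \<Rightarrow> real) \<Rightarrow> bool" where
  "stationary_seq M X \<longleftrightarrow>
     (\<forall>I s. finite I \<and> I \<subseteq> {1..} \<longrightarrow>
        distr M (Pi\<^sub>M I (\<lambda>_. borel)) (\<lambda>\<omega>. \<lambda>i\<in>I. X (i + s) \<omega>)
      = distr M (Pi\<^sub>M I (\<lambda>_. borel)) (\<lambda>\<omega>. \<lambda>i\<in>I. X i \<omega>))"

text \<open>m-dependence of (X_i)_{i>=1}: families indexed by A, B within {1..} with
  rho(A,B) = inf{|i-j|} > m are independent.  (If A or B is empty, rho = +infinity.)\<close>
definition m_dependent :: "'a measure \<Rightarrow> nat \<Rightarrow> (nat \<Rightarrow> 'a \<Rightarrow> real) \<Rightarrow> bool" where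
  "m_dependent M m X \<longleftrightarrow>
     (\<forall>A B. A \<subseteq> {1..} \<and> B \<subseteq> {1..} \<and> (\<forall>i\<in>A. \<forall>j\<in>B. m < nat \<bar>int i - int j\<bar>) \<longrightarrow>
        prob_space.indep_var M (Pi\<^sub>M A (\<lambda>_. borel)) (\<lambda>\<omega>. \<lambda>i\<in>A. X i \<omega>)
                                (Pi\<^sub>M B (\<lambda>_. borel)) (\<lambda>\<omega>. \<lambda>i\<in>B. X i \<omega>))"

end

theory Submission
  imports Defs "HOL-Real_Asymp.Real_Asymp"
begin

text \<open>
  Write \<open>S\<^sub>k\<close> for the partial sums of \<open>X\<^sub>i - \<mu>\<close>, so that the numerator is
  \<open>S\<^bsub>N\<^sub>n\<^esub> + \<mu> (N\<^sub>n - n \<nu>)\<close>. By \<open>m\<close>-dependence \<open>E (S\<^sub>l - S\<^sub>k)\<^sup>2 \<le> D \<bar>l - k\<bar>\<close>; since \<open>N\<^sub>n\<close> is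
  independent of \<open>X\<close> and deviates from \<open>k\<^sub>n = \<lfloor>n \<nu>\<rfloor>\<close> by \<open>O(sqrt n)\<close>, replacing \<open>S\<^bsub>N\<^sub>n\<^esub>\<close> by the
  deterministic-index sum \<open>S\<^bsub>k\<^sub>n\<^esub>\<close> costs only \<open>O(n powr (1/4))\<close> in \<open>L\<^sup>1\<close>. After this replacement
  the two summands are independent and the characteristic function factors. One factor is the
  classical limit for sums of i.i.d. variables, the other the central limit theorem for \<open>m\<close>-dependent
  sequences, obtained from i.i.d. blocks of fixed length \<open>p\<close> separated by gaps of length \<open>m\<close>, with
  \<open>p\<close> sent to infinity last. Levy's continuity theorem concludes.
\<close>

subsection \<open>Characteristic functions and second moments\<close>

text \<open>Taking logarithms, \<open>r n * ln (1 - x n)\<close> differs from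
  \<open>- r n * x n\<close> by at most \<open>2 * r n * (x n)\<^sup>2\<close>, a product of the
  convergent \<open>r n * x n\<close> and the vanishing \<open>x n\<close>.\<close>

lemma tendsto_one_minus_power_exp:
  fixes x :: "nat \<Rightarrow> real" and r :: "nat \<Rightarrow> nat"
  assumes x: "x \<longlonglongrightarrow> 0" and rx: "(\<lambda>n. real (r n) * x n) \<longlonglongrightarrow> c"
  shows "(\<lambda>n. (1 - x n) ^ r n) \<longlonglongrightarrow> exp (- c)"
proof -
  have ev: "\<forall>\<^sub>F n in sequentially. \<bar>x n\<bar> < 1 / 2"
    using order_tendstoD(2)[OF tendsto_rabs_zero[OF x], of "1/2"] by simp
  have "(\<lambda>n. 2 * (real (r n) * x n) * x n) \<longlonglongrightarrow> 2 * c * 0"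
    by (intro tendsto_intros rx x)
  then have 0: "(\<lambda>n. \<bar>2 * (real (r n) * x n) * x n\<bar>) \<longlonglongrightarrow> 0"
    by (simp add: tendsto_rabs_zero_iff)
  have "(\<lambda>n. real (r n) * ln (1 - x n) + real (r n) * x n) \<longlonglongrightarrow> 0"
  proof (rule Lim_null_comparison[OF _ 0])
    show "\<forall>\<^sub>F n in sequentially. norm (real (r n) * ln (1 - x n) + real (r n) * x n)
        \<le> \<bar>2 * (real (r n) * x n) * x n\<bar>"
      using ev
    proof eventually_elim
      case (elim n)
      have "norm (real (r n) * ln (1 - x n) + real (r n) * x n)
          = real (r n) * \<bar>ln (1 + - x n) - - x n\<bar>"
        by (simp only: distrib_left[symmetric] real_norm_def abs_mult) simp
      also have "\<dots> \<le> real (r n) * (2 * (- x n)\<^sup>2)"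
        using elim by (intro mult_left_mono abs_ln_one_plus_x_minus_x_bound) auto
      also have "\<dots> = \<bar>2 * (real (r n) * x n) * x n\<bar>"
        by (simp add: abs_mult power2_eq_square mult.assoc)
      finally show ?case .
    qed
  qed
  from tendsto_diff[OF this rx] have "(\<lambda>n. exp (real (r n) * ln (1 - x n))) \<longlonglongrightarrow> exp (- c)"
    by (intro tendsto_intros) simp
  then show ?thesis
  proof (rule Lim_transform_eventually)
    show "\<forall>\<^sub>F n in sequentially. exp (real (r n) * ln (1 - x n)) = (1 - x n) ^ r n"
      using ev by eventually_elim (simp add: exp_of_nat_mult)
  qed
qed

text \<open>By Taylor expansion the characteristic function at \<open>u n\<close> is
  \<open>1 - (u n)\<^sup>2 * w / 2\<close> up to \<open>(u n)\<^sup>2 / 6 * E n\<close>, and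
  \<open>E n\<close> vanishes by dominated convergence with majorant \<open>6 * x\<^sup>2\<close>.
  The power multiplies this error by at most \<open>r n\<close>, which the convergent
  \<open>r n * (u n)\<^sup>2\<close> absorbs. Exponent and frequency are decoupled so that the lemma
  serves both i.i.d. sums, where \<open>r n = n\<close>, and sums of blocks.\<close>

lemma (in real_distribution) char_power_tendsto:
  fixes u :: "nat \<Rightarrow> real" and r :: "nat \<Rightarrow> nat"
  assumes int1: "integrable M (\<lambda>x. x)" and mean: "expectation (\<lambda>x. x) = 0"
    and int2: "integrable M (\<lambda>x. x\<^sup>2)" and var: "expectation (\<lambda>x. x\<^sup>2) = w"
    and u: "u \<longlonglongrightarrow> 0" and ru: "(\<lambda>n. real (r n) * (u n)\<^sup>2) \<longlonglongrightarrow> c"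
  shows "(\<lambda>n. char M (u n) ^ r n) \<longlonglongrightarrow> complex_of_real (exp (- (c * w / 2)))"
proof -
  define E where "E n = expectation (\<lambda>x. min (6 * x\<^sup>2) (\<bar>u n\<bar> * \<bar>x\<bar> ^ 3))" for n
  have "w \<ge> 0" unfolding var[symmetric] by simp
  have "(\<lambda>n. min (6 * x\<^sup>2) (\<bar>u n\<bar> * \<bar>x\<bar> ^ 3)) \<longlonglongrightarrow> min (6 * x\<^sup>2) (0 * \<bar>x\<bar> ^ 3)" for x
    by (intro tendsto_intros tendsto_rabs_zero u)
  then have "(\<lambda>n. min (6 * x\<^sup>2) (\<bar>u n\<bar> * \<bar>x\<bar> ^ 3)) \<longlonglongrightarrow> 0" for x
    by (simp add: min_absorb2)
  then have "E \<longlonglongrightarrow> expectation (\<lambda>x. 0)"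
    unfolding E_def using int2
    by (intro integral_dominated_convergence[where w = "\<lambda>x. 6 * x\<^sup>2"]) auto
  then have E: "E \<longlonglongrightarrow> 0" by simp
  define x where "x n = (u n)\<^sup>2 * w / 2" for n
  have "(\<lambda>n. (u n)\<^sup>2 * w / 2) \<longlonglongrightarrow> 0\<^sup>2 * w / 2" by (intro tendsto_intros u) simp
  then have x0: "x \<longlonglongrightarrow> 0" unfolding x_def by simp
  have "(\<lambda>n. (real (r n) * (u n)\<^sup>2) * (w / 2)) \<longlonglongrightarrow> c * (w / 2)" by (intro tendsto_intros ru)
  then have "(\<lambda>n. (1 - x n) ^ r n) \<longlonglongrightarrow> exp (- (c * w / 2))"
    by (intro tendsto_one_minus_power_exp x0) (simp add: x_def mult_ac)
  then have lim: "(\<lambda>n. complex_of_real ((1 - x n) ^ r n)) \<longlonglongrightarrow> complex_of_real (exp (- (c * w / 2)))"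
    by (rule tendsto_of_real)
  have "(\<lambda>n. (real (r n) * (u n)\<^sup>2) / 6 * E n) \<longlonglongrightarrow> c / 6 * 0"
    by (intro tendsto_intros ru E) simp
  then have bound0: "(\<lambda>n. (real (r n) * (u n)\<^sup>2) / 6 * E n) \<longlonglongrightarrow> 0" by simp
  have "(\<lambda>n. char M (u n) ^ r n - complex_of_real ((1 - x n) ^ r n)) \<longlonglongrightarrow> 0"
  proof (rule Lim_null_comparison[OF _ bound0])
    \<comment> \<open>The comparison of powers needs both bases in the closed unit disc;
      \<open>0 \<le> x n < 1\<close> puts \<open>1 - x n\<close> there.\<close>
    have "\<forall>\<^sub>F n in sequentially. x n < 1" using order_tendstoD(2)[OF x0, of 1] by simp
    then show "\<forall>\<^sub>F n in sequentially. norm (char M (u n) ^ r n - complex_of_real ((1 - x n) ^ r n))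
       \<le> (real (r n) * (u n)\<^sup>2) / 6 * E n"
    proof eventually_elim
      case (elim n)
      have "x n \<ge> 0" using \<open>w \<ge> 0\<close> by (simp add: x_def)
      have "norm (char M (u n) ^ r n - complex_of_real (1 - x n) ^ r n)
          \<le> real (r n) * norm (char M (u n) - complex_of_real (1 - x n))"
        using elim \<open>x n \<ge> 0\<close>
        by (intro norm_power_diff cmod_char_le_1) (simp del: of_real_diff)
      also have "norm (char M (u n) - complex_of_real (1 - x n)) \<le> (u n)\<^sup>2 / 6 * E n"
        using char_approx3[OF int1 mean int2, of w "u n"] mean var by (simp add: x_def E_def)
      finally show ?case by (simp add: mult_left_mono)
    qed
  qed
  from Lim_transform[OF lim this] show ?thesis .
qed

text \<open>The map \<open>iexp (t * x)\<close> is Lipschitz in \<open>x\<close> with constant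
  \<open>\<bar>t\<bar>\<close>. The bound serves twice: for discarding the gaps between blocks and
  for replacing the random index by a deterministic one.\<close>

lemma (in prob_space) char_distr_dist_le:
  fixes A B :: "'a \<Rightarrow> real"
  assumes [measurable]: "A \<in> borel_measurable M" "B \<in> borel_measurable M"
    and int: "integrable M (\<lambda>\<omega>. A \<omega> - B \<omega>)"
  shows "dist (char (distr M borel A) t) (char (distr M borel B) t)
      \<le> \<bar>t\<bar> * expectation (\<lambda>\<omega>. \<bar>A \<omega> - B \<omega>\<bar>)"
proof -
  have le: "norm (iexp (t * a) - iexp (t * b)) \<le> \<bar>t\<bar> * \<bar>a - b\<bar>" for a b :: real
  proof -
    have "iexp (t * a) - iexp (t * b) = iexp (t * b) * (iexp (t * a - t * b) - 1)"
      by (simp add: right_diff_distrib mult_exp_exp)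
    then have "norm (iexp (t * a) - iexp (t * b)) = norm (iexp (t * a - t * b) - 1)"
      by (simp add: norm_mult del: of_real_mult of_real_diff)
    also have "\<dots> \<le> \<bar>t * a - t * b\<bar>"
      using iexp_approx1[of "t * a - t * b" 0] by simp
    finally show ?thesis by (simp only: right_diff_distrib[symmetric] abs_mult)
  qed
  have I: "integrable M (\<lambda>\<omega>. iexp (t * A \<omega>))" "integrable M (\<lambda>\<omega>. iexp (t * B \<omega>))"
    by (auto intro!: integrable_iexp simp del: of_real_mult)
  have "dist (char (distr M borel A) t) (char (distr M borel B) t)
      = norm (expectation (\<lambda>\<omega>. iexp (t * A \<omega>) - iexp (t * B \<omega>)))"
    using I by (simp add: char_def integral_distr dist_norm)
  also have "\<dots> \<le> expectation (\<lambda>\<omega>. norm (iexp (t * A \<omega>) - iexp (t * B \<omega>)))"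
    by (rule integral_norm_bound)
  also have "\<dots> \<le> expectation (\<lambda>\<omega>. \<bar>t\<bar> * \<bar>A \<omega> - B \<omega>\<bar>)"
    using I int le by (intro integral_mono) auto
  finally show ?thesis by simp
qed

text \<open>This is nonnegativity of the variance of the absolute value.\<close>

lemma (in prob_space) expectation_abs_le_sqrt:
  fixes Z :: "'a \<Rightarrow> real"
  assumes [measurable]: "Z \<in> borel_measurable M" and int: "integrable M (\<lambda>\<omega>. (Z \<omega>)\<^sup>2)"
  shows "expectation (\<lambda>\<omega>. \<bar>Z \<omega>\<bar>) \<le> sqrt (expectation (\<lambda>\<omega>. (Z \<omega>)\<^sup>2))"
proof (rule real_le_rsqrt)
  have I: "integrable M (\<lambda>\<omega>. \<bar>Z \<omega>\<bar>)"
    using square_integrable_imp_integrable[OF _ int] by auto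
  then show "(expectation (\<lambda>\<omega>. \<bar>Z \<omega>\<bar>))\<^sup>2 \<le> expectation (\<lambda>\<omega>. (Z \<omega>)\<^sup>2)"
    using variance_positive[of "\<lambda>\<omega>. \<bar>Z \<omega>\<bar>"] variance_eq[OF I] int by simp
qed

text \<open>A three-epsilon argument for iterated limits: \<open>n\<close> goes to infinity with
  \<open>p\<close> fixed, then \<open>p\<close>. For fixed \<open>p\<close> the error need not
  vanish; only its limit \<open>E p\<close> has to become small.\<close>

lemma tendsto_by_approximation:
  fixes f :: "nat \<Rightarrow> 'b::metric_space" and h :: "nat \<Rightarrow> nat \<Rightarrow> 'b"
    and err :: "nat \<Rightarrow> nat \<Rightarrow> real"
  assumes close: "\<And>p n. dist (f n) (h p n) \<le> err p n"
    and h: "\<And>p. h p \<longlonglongrightarrow> L p" and err: "\<And>p. err p \<longlonglongrightarrow> E p"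
    and L: "L \<longlonglongrightarrow> l" and E: "E \<longlonglongrightarrow> 0"
  shows "f \<longlonglongrightarrow> l"
proof (rule tendstoI)
  fix e :: real assume "e > 0"
  then have "\<forall>\<^sub>F p in sequentially. dist (L p) l < e / 3 \<and> E p < e / 3"
    using tendstoD[OF L, of "e / 3"] order_tendstoD(2)[OF E, of "e / 3"] by (simp add: eventually_conj)
  then obtain p where p: "dist (L p) l < e / 3" "E p < e / 3"
    by (auto simp: eventually_sequentially)
  have "\<forall>\<^sub>F n in sequentially. dist (h p n) (L p) < e / 3"
    using tendstoD[OF h, of "e / 3"] \<open>e > 0\<close> by simp
  moreover have "\<forall>\<^sub>F n in sequentially. err p n < e / 3"
    using order_tendstoD(2)[OF err p(2)] .
  ultimately show "\<forall>\<^sub>F n in sequentially. dist (f n) l < e"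
  proof eventually_elim
    case (elim n)
    have "dist (f n) l \<le> dist (f n) (h p n) + (dist (h p n) (L p) + dist (L p) l)"
      by (meson add_left_mono dist_triangle order_trans)
    then show ?case using close[of n p] elim p by linarith
  qed
qed

lemma abs_mult_le_squares: "\<bar>x * y\<bar> \<le> (x\<^sup>2 + y\<^sup>2) / 2" for x y :: real
  using sum_squares_bound[of "\<bar>x\<bar>" "\<bar>y\<bar>"] by (simp add: abs_mult)

text \<open>The cross terms vanish because the new summand is centred and independent of the earlier
  sum. Integrability travels in the same induction since splitting the expectation of the square
  requires it.\<close>

lemma (in prob_space) expectation_indep_sum_square:
  fixes V :: "'i \<Rightarrow> 'a \<Rightarrow> real"
  assumes "finite A" and "indep_vars (\<lambda>_. borel) V A"
    and "\<And>i. i \<in> A \<Longrightarrow> integrable M (\<lambda>\<omega>. (V i \<omega>)\<^sup>2)"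
    and "\<And>i. i \<in> A \<Longrightarrow> expectation (V i) = 0"
  shows "integrable M (\<lambda>\<omega>. (\<Sum>i\<in>A. V i \<omega>)\<^sup>2) \<and>
    expectation (\<lambda>\<omega>. (\<Sum>i\<in>A. V i \<omega>)\<^sup>2) = (\<Sum>i\<in>A. expectation (\<lambda>\<omega>. (V i \<omega>)\<^sup>2))"
  using assms
proof (induction A rule: finite_induct)
  case (insert x F)
  have rv: "V i \<in> borel_measurable M" if "i \<in> insert x F" for i
    using insert.prems(1) that by (auto simp: indep_vars_def2)
  have int: "integrable M (V i)" if "i \<in> insert x F" for i
    using square_integrable_imp_integrable[OF rv] insert.prems(2) that by auto
  have IH: "integrable M (\<lambda>\<omega>. (\<Sum>i\<in>F. V i \<omega>)\<^sup>2)"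
    "expectation (\<lambda>\<omega>. (\<Sum>i\<in>F. V i \<omega>)\<^sup>2) = (\<Sum>i\<in>F. expectation (\<lambda>\<omega>. (V i \<omega>)\<^sup>2))"
    using insert.IH insert.prems indep_vars_subset[OF insert.prems(1), of F] by auto
  have ind: "indep_var borel (V x) borel (\<lambda>\<omega>. \<Sum>i\<in>F. V i \<omega>)"
    using insert.hyps insert.prems(1) by (rule indep_vars_sum)
  have intF: "integrable M (\<lambda>\<omega>. \<Sum>i\<in>F. V i \<omega>)"
    using int by (intro Bochner_Integration.integrable_sum) auto
  have cross: "integrable M (\<lambda>\<omega>. V x \<omega> * (\<Sum>i\<in>F. V i \<omega>))"
    "expectation (\<lambda>\<omega>. V x \<omega> * (\<Sum>i\<in>F. V i \<omega>)) = 0"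
    using indep_var_integrable[OF ind int intF] indep_var_lebesgue_integral[OF ind int intF]
      insert.prems(3) by auto
  have sq: "(\<Sum>i\<in>insert x F. V i \<omega>)\<^sup>2
      = (V x \<omega>)\<^sup>2 + (\<Sum>i\<in>F. V i \<omega>)\<^sup>2 + 2 * (V x \<omega> * (\<Sum>i\<in>F. V i \<omega>))" for \<omega>
    using insert.hyps by (simp add: power2_sum)
  show ?case
    unfolding sq using insert.hyps insert.prems(2)[of x] IH cross by simp
qed simp

subsection \<open>Stationary m-dependent sequences\<close>

locale stationary_m_dependent = prob_space M for M :: "'a measure" +
  fixes m :: nat and X :: "nat \<Rightarrow> 'a \<Rightarrow> real"
  assumes X_measurable: "\<And>i. i \<ge> 1 \<Longrightarrow> X i \<in> borel_measurable M"
    and X_stationary: "stationary_seq M X"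
    and X_m_dependent: "m_dependent M m X"
    and X_square_integrable: "integrable M (\<lambda>\<omega>. (X 1 \<omega>)\<^sup>2)"
begin

definition Z :: "nat \<Rightarrow> 'a \<Rightarrow> real" where
  "Z i \<omega> = X i \<omega> - expectation (X 1)"

text \<open>Index sets are arbitrary because the block argument sums over separated intervals and
  over what they leave out.\<close>

definition S :: "nat set \<Rightarrow> 'a \<Rightarrow> real" where
  "S A \<omega> = (\<Sum>i\<in>A. Z i \<omega>)"

definition autocov :: "nat \<Rightarrow> real" where
  "autocov j = cov M (X 1) (X (1 + j))"

text \<open>The amount by which the second moment of \<open>S {1..p}\<close> grows per added index
  once \<open>p \<ge> m\<close>.\<close>

definition long_run_variance :: real where
  "long_run_variance = variance (X 1) + 2 * (\<Sum>j=1..m. autocov j)"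

section \<open>Consequences of stationarity and of \<open>m\<close>-dependence\<close>

lemma Z_measurable: "i \<ge> 1 \<Longrightarrow> Z i \<in> borel_measurable M"
  unfolding Z_def using X_measurable[of i] by measurable

lemma S_measurable: "A \<subseteq> {1..} \<Longrightarrow> S A \<in> borel_measurable M"
  unfolding S_def using Z_measurable by (intro borel_measurable_sum) auto

text \<open>Pushing the shift-invariant law of finitely many coordinates forward along
  \<open>g\<close> carries the invariance over to any measurable functional of them.\<close>

lemma distr_shift:
  assumes "finite I" "I \<subseteq> {1..}" and g: "g \<in> measurable (Pi\<^sub>M I (\<lambda>_. borel)) N"
  shows "distr M N (\<lambda>\<omega>. g (\<lambda>i\<in>I. X (i + s) \<omega>)) = distr M N (\<lambda>\<omega>. g (\<lambda>i\<in>I. X i \<omega>))"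
proof -
  have *: "(\<lambda>\<omega>. \<lambda>i\<in>I. X (i + t) \<omega>) \<in> measurable M (Pi\<^sub>M I (\<lambda>_. borel))" for t
    using assms(2) by (intro measurable_restrict X_measurable) auto
  have "distr M N (\<lambda>\<omega>. g (\<lambda>i\<in>I. X (i + t) \<omega>))
      = distr (distr M (Pi\<^sub>M I (\<lambda>_. borel)) (\<lambda>\<omega>. \<lambda>i\<in>I. X (i + t) \<omega>)) N g" for t
    by (subst distr_distr[OF g *]) (simp add: comp_def)
  from this[of s] this[of 0] show ?thesis
    using X_stationary assms(1,2) by (simp add: stationary_seq_def)
qed

lemma distr_X:
  assumes "i \<ge> 1"
  shows "distr M borel (X i) = distr M borel (X 1)"
  using distr_shift[of "{1}" "\<lambda>f. f 1" borel "i - 1"] assms by simp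

lemma integrable_comp_X_iff:
  fixes h :: "real \<Rightarrow> real"
  assumes "i \<ge> 1" and [measurable]: "h \<in> borel_measurable borel"
  shows "integrable M (\<lambda>\<omega>. h (X i \<omega>)) \<longleftrightarrow> integrable M (\<lambda>\<omega>. h (X 1 \<omega>))"
  using distr_X[OF assms(1)] X_measurable[of 1] X_measurable[OF assms(1)]
  by (metis integrable_distr_eq assms(2) order_refl)

lemma expectation_comp_X:
  fixes h :: "real \<Rightarrow> real"
  assumes "i \<ge> 1" and [measurable]: "h \<in> borel_measurable borel"
  shows "expectation (\<lambda>\<omega>. h (X i \<omega>)) = expectation (\<lambda>\<omega>. h (X 1 \<omega>))"
  using distr_X[OF assms(1)] X_measurable[of 1] X_measurable[OF assms(1)]
  by (metis integral_distr assms(2) order_refl)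

lemma integrable_X: "i \<ge> 1 \<Longrightarrow> integrable M (X i)"
  using square_integrable_imp_integrable[OF X_measurable[of i]]
    integrable_comp_X_iff[of i "\<lambda>x. x\<^sup>2"] X_square_integrable by simp

lemma expectation_X: "i \<ge> 1 \<Longrightarrow> expectation (X i) = expectation (X 1)"
  using expectation_comp_X[of i "\<lambda>x. x"] by simp

lemma integrable_Z: "i \<ge> 1 \<Longrightarrow> integrable M (Z i)"
  unfolding Z_def using integrable_X by simp

lemma expectation_Z: "i \<ge> 1 \<Longrightarrow> expectation (Z i) = 0"
  unfolding Z_def using integrable_X[of i] expectation_X[of i] by (simp add: prob_space)

lemma integrable_Z_square: "i \<ge> 1 \<Longrightarrow> integrable M (\<lambda>\<omega>. (Z i \<omega>)\<^sup>2)"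
  using integrable_comp_X_iff[of i "\<lambda>x. (x - expectation (X 1))\<^sup>2"]
    X_square_integrable integrable_X[of 1]
  by (simp add: Z_def power2_diff)

lemma expectation_Z_square: "i \<ge> 1 \<Longrightarrow> expectation (\<lambda>\<omega>. (Z i \<omega>)\<^sup>2) = variance (X 1)"
  using expectation_comp_X[of i "\<lambda>x. (x - expectation (X 1))\<^sup>2"]
  by (simp add: Z_def)

lemma integrable_Z_mult:
  assumes "i \<ge> 1" "j \<ge> 1"
  shows "integrable M (\<lambda>\<omega>. Z i \<omega> * Z j \<omega>)"
proof (rule Bochner_Integration.integrable_bound)
  show "integrable M (\<lambda>\<omega>. ((Z i \<omega>)\<^sup>2 + (Z j \<omega>)\<^sup>2) / 2)"
    using assms integrable_Z_square by simp
  show "AE \<omega> in M. norm (Z i \<omega> * Z j \<omega>) \<le> norm (((Z i \<omega>)\<^sup>2 + (Z j \<omega>)\<^sup>2) / 2)"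
    using abs_mult_le_squares by (intro AE_I2) auto
qed (use Z_measurable assms in measurable)

lemma expectation_Z_mult_le:
  assumes "i \<ge> 1" "j \<ge> 1"
  shows "expectation (\<lambda>\<omega>. Z i \<omega> * Z j \<omega>) \<le> variance (X 1)"
proof -
  have "expectation (\<lambda>\<omega>. Z i \<omega> * Z j \<omega>) \<le> expectation (\<lambda>\<omega>. ((Z i \<omega>)\<^sup>2 + (Z j \<omega>)\<^sup>2) / 2)"
    using assms integrable_Z_mult integrable_Z_square
    by (intro integral_mono abs_le_D1[OF abs_mult_le_squares]) auto
  also have "\<dots> = variance (X 1)"
    using assms by (simp add: integrable_Z_square expectation_Z_square)
  finally show ?thesis .
qed

lemma expectation_Z_mult:
  assumes "i \<ge> 1"
  shows "expectation (\<lambda>\<omega>. Z i \<omega> * Z (i + j) \<omega>) = autocov j"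
proof -
  define c where "c = expectation (X 1)"
  define g where "g f = (f 1 - c) * (f (1 + j) - c)" for f :: "nat \<Rightarrow> real"
  have g: "g \<in> borel_measurable (Pi\<^sub>M {1, 1 + j} (\<lambda>_. borel))"
    unfolding g_def by measurable
  have [measurable]: "X i \<in> borel_measurable M" "X (i + j) \<in> borel_measurable M"
    "X 1 \<in> borel_measurable M" "X (1 + j) \<in> borel_measurable M"
    using assms by (auto intro!: X_measurable)
  have "distr M borel (\<lambda>\<omega>. (X i \<omega> - c) * (X (i + j) \<omega> - c))
      = distr M borel (\<lambda>\<omega>. (X 1 \<omega> - c) * (X (1 + j) \<omega> - c))"
    using distr_shift[OF _ _ g, of "i - 1"] assms by (simp add: g_def add.commute)
  then have "(\<integral>x. x \<partial>distr M borel (\<lambda>\<omega>. (X i \<omega> - c) * (X (i + j) \<omega> - c)))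
      = (\<integral>x. x \<partial>distr M borel (\<lambda>\<omega>. (X 1 \<omega> - c) * (X (1 + j) \<omega> - c)))"
    by simp
  then have "expectation (\<lambda>\<omega>. (X i \<omega> - c) * (X (i + j) \<omega> - c))
      = expectation (\<lambda>\<omega>. (X 1 \<omega> - c) * (X (1 + j) \<omega> - c))"
    by (subst (asm) (1 2) integral_distr) measurable
  \<comment> \<open>\<open>cov\<close> centres each factor at its own mean; by stationarity the mean
    of \<open>X (1 + j)\<close> is again \<open>c\<close>.\<close>
  then show ?thesis
    using expectation_X[of "1 + j"] by (simp add: autocov_def cov_def Z_def c_def)
qed

text \<open>Each sum is a measurable image of its own family, and the two families are more than
  \<open>m\<close> apart. The gap is stated in ordered form because blocks are split off from left
  to right.\<close>

lemma indep_var_S: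
  assumes A: "A \<subseteq> {1..}" and B: "B \<subseteq> {1..}"
    and gap: "\<And>i j. i \<in> A \<Longrightarrow> j \<in> B \<Longrightarrow> i + m < j"
  shows "indep_var borel (S A) borel (S B)"
proof -
  have g: "(\<lambda>f. \<Sum>i\<in>A. f i - expectation (X 1)) \<in> borel_measurable (Pi\<^sub>M A (\<lambda>_. borel))" for A
    by measurable
  have "indep_var (Pi\<^sub>M A (\<lambda>_. borel)) (\<lambda>\<omega>. \<lambda>i\<in>A. X i \<omega>) (Pi\<^sub>M B (\<lambda>_. borel)) (\<lambda>\<omega>. \<lambda>i\<in>B. X i \<omega>)"
  proof -
    have "m < nat \<bar>int i - int j\<bar>" if "i \<in> A" "j \<in> B" for i j
      using gap[OF that] by linarith
    then show ?thesis using X_m_dependent A B unfolding m_dependent_def by blast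
  qed
  from indep_var_compose[OF this g g] show ?thesis
    by (simp add: comp_def S_def[abs_def] Z_def[abs_def])
qed

text \<open>\<open>Z 1\<close> and \<open>Z (1 + j)\<close> are then independent and
  centred.\<close>

lemma autocov_eq_0:
  assumes "m < j"
  shows "autocov j = 0"
proof -
  have "indep_var borel (Z 1) borel (Z (1 + j))"
    using indep_var_S[of "{1}" "{1 + j}"] assms by (simp add: S_def[abs_def])
  then have "expectation (\<lambda>\<omega>. Z 1 \<omega> * Z (1 + j) \<omega>) = 0"
    using indep_var_lebesgue_integral[of "Z 1" "Z (1 + j)"] integrable_Z by (simp add: expectation_Z)
  then show ?thesis using expectation_Z_mult[of 1 j] by simp
qed

section \<open>Second moments of the centred sums\<close>

lemma S_square: "(S A \<omega>)\<^sup>2 = (\<Sum>i\<in>A. \<Sum>j\<in>A. Z i \<omega> * Z j \<omega>)"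
  by (simp add: S_def power2_eq_square sum_product)

lemma integrable_S: "A \<subseteq> {1..} \<Longrightarrow> integrable M (S A)"
  unfolding S_def using integrable_Z by (intro Bochner_Integration.integrable_sum) auto

lemma expectation_S: "A \<subseteq> {1..} \<Longrightarrow> expectation (S A) = 0"
  unfolding S_def
  by (subst Bochner_Integration.integral_sum) (auto intro!: integrable_Z sum.neutral expectation_Z)

lemma integrable_S_square: "A \<subseteq> {1..} \<Longrightarrow> integrable M (\<lambda>\<omega>. (S A \<omega>)\<^sup>2)"
  unfolding S_square using integrable_Z_mult
  by (intro Bochner_Integration.integrable_sum) auto

text \<open>Each index has at most \<open>2 * m + 1\<close> correlated neighbours, itself included.\<close>

definition D :: real where "D = (2 * real m + 1) * variance (X 1)"

lemma D_nonneg: "D \<ge> 0"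
  unfolding D_def using variance_positive by (intro mult_nonneg_nonneg) auto

lemma expectation_S_square_le:
  assumes A: "A \<subseteq> {1..}" "finite A"
  shows "expectation (\<lambda>\<omega>. (S A \<omega>)\<^sup>2) \<le> real (card A) * D"
proof -
  have le: "(\<Sum>j\<in>A. expectation (\<lambda>\<omega>. Z i \<omega> * Z j \<omega>)) \<le> D" if "i \<in> A" for i
  proof -
    \<comment> \<open>If \<open>i < m\<close>, the subtraction truncates at 0 and the window only
      shrinks, so \<open>2 * m + 1\<close> still bounds its size.\<close>
    let ?B = "A \<inter> {i - m..i + m}"
    have zero: "expectation (\<lambda>\<omega>. Z i \<omega> * Z j \<omega>) = 0" if "j \<in> A - ?B" for j
    proof (cases "i \<le> j")
      case True
      then show ?thesis
        using expectation_Z_mult[of i "j - i"] autocov_eq_0[of "j - i"] that \<open>i \<in> A\<close> A by auto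
    next
      case False
      then show ?thesis
        using expectation_Z_mult[of j "i - j"] autocov_eq_0[of "i - j"] that \<open>i \<in> A\<close> A
        by (auto simp: mult.commute)
    qed
    have "(\<Sum>j\<in>A. expectation (\<lambda>\<omega>. Z i \<omega> * Z j \<omega>)) = (\<Sum>j\<in>?B. expectation (\<lambda>\<omega>. Z i \<omega> * Z j \<omega>))"
      using A zero by (intro sum.mono_neutral_right) auto
    also have "\<dots> \<le> (\<Sum>j\<in>?B. variance (X 1))"
      using A that by (intro sum_mono expectation_Z_mult_le) auto
    also have "\<dots> = real (card ?B) * variance (X 1)" by simp
    also have "card ?B \<le> card {i - m..i + m}" by (rule card_mono) auto
    also have "card {i - m..i + m} \<le> 2 * m + 1" by simp
    finally show ?thesis using variance_positive[of "X 1"]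
      by (simp add: D_def mult_right_mono add.commute)
  qed
  have "expectation (\<lambda>\<omega>. (S A \<omega>)\<^sup>2) = (\<Sum>i\<in>A. \<Sum>j\<in>A. expectation (\<lambda>\<omega>. Z i \<omega> * Z j \<omega>))"
    unfolding S_square using A
    by (subst Bochner_Integration.integral_sum)
      (auto intro!: sum.cong Bochner_Integration.integral_sum Bochner_Integration.integrable_sum integrable_Z_mult)
  also have "\<dots> \<le> real (card A) * D" using le by (rule sum_bounded_above)
  finally show ?thesis .
qed

text \<open>The new index contributes its own variance and twice its covariances with all earlier
  indices. For \<open>p \<ge> m\<close> the lags \<open>1..m\<close> all occur among them and larger
  lags contribute nothing, so the increment no longer depends on \<open>p\<close>.\<close>

lemma expectation_S_square_Suc:
  assumes "p \<ge> m"
  shows "expectation (\<lambda>\<omega>. (S {1..Suc p} \<omega>)\<^sup>2) = expectation (\<lambda>\<omega>. (S {1..p} \<omega>)\<^sup>2) + long_run_variance"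
proof -
  have "(S {1..Suc p} \<omega>)\<^sup>2 = (S {1..p} \<omega>)\<^sup>2 + 2 * (\<Sum>i=1..p. Z i \<omega> * Z (Suc p) \<omega>) + (Z (Suc p) \<omega>)\<^sup>2" for \<omega>
    by (simp add: S_def power2_sum sum_distrib_right[symmetric])
  moreover have "integrable M (\<lambda>\<omega>. (S {1..p} \<omega>)\<^sup>2)" "integrable M (\<lambda>\<omega>. (Z (Suc p) \<omega>)\<^sup>2)"
    "integrable M (\<lambda>\<omega>. \<Sum>i=1..p. Z i \<omega> * Z (Suc p) \<omega>)"
    by (auto intro!: integrable_S_square integrable_Z_square integrable_Z_mult
        Bochner_Integration.integrable_sum)
  ultimately have "expectation (\<lambda>\<omega>. (S {1..Suc p} \<omega>)\<^sup>2) = expectation (\<lambda>\<omega>. (S {1..p} \<omega>)\<^sup>2)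
      + 2 * expectation (\<lambda>\<omega>. \<Sum>i=1..p. Z i \<omega> * Z (Suc p) \<omega>) + expectation (\<lambda>\<omega>. (Z (Suc p) \<omega>)\<^sup>2)"
    by (simp del: Bochner_Integration.integral_sum)
  also have "expectation (\<lambda>\<omega>. \<Sum>i=1..p. Z i \<omega> * Z (Suc p) \<omega>)
      = (\<Sum>i=1..p. expectation (\<lambda>\<omega>. Z i \<omega> * Z (Suc p) \<omega>))"
    by (intro Bochner_Integration.integral_sum integrable_Z_mult) auto
  also have "\<dots> = (\<Sum>i=1..p. autocov (Suc p - i))"
    using expectation_Z_mult by (intro sum.cong refl) (metis atLeastAtMost_iff le_SucI le_add_diff_inverse)
  also have "\<dots> = (\<Sum>j=1..p. autocov j)"
    by (rule sum.reindex_bij_witness[of _ "\<lambda>j. Suc p - j" "\<lambda>j. Suc p - j"]) auto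
  also have "\<dots> = (\<Sum>j=1..m. autocov j)"
    using assms by (intro sum.mono_neutral_right) (auto intro!: autocov_eq_0)
  also have "expectation (\<lambda>\<omega>. (Z (Suc p) \<omega>)\<^sup>2) = variance (X 1)"
    by (rule expectation_Z_square) simp
  finally show ?thesis by (simp add: long_run_variance_def)
qed

text \<open>From \<open>p = m\<close> on, the second moment is affine in \<open>p\<close> with slope
  \<open>long_run_variance\<close>. The divisor \<open>p + m\<close> is the length of a block with
  its gap; rewriting the quotient over it produces the constant
  \<open>w m - 2 * real m * long_run_variance\<close>.\<close>

lemma expectation_S_square_tendsto:
  "(\<lambda>p. expectation (\<lambda>\<omega>. (S {1..p} \<omega>)\<^sup>2) / real (p + m)) \<longlonglongrightarrow> long_run_variance"
proof -
  define w where "w p = expectation (\<lambda>\<omega>. (S {1..p} \<omega>)\<^sup>2)" for p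
  have w: "w (m + d) = w m + real d * long_run_variance" for d
  proof (induction d)
    case (Suc d)
    then show ?case using expectation_S_square_Suc[of "m + d"] by (simp add: w_def algebra_simps)
  qed simp
  have inv: "(\<lambda>p. 1 / real (p + m)) \<longlonglongrightarrow> 0"
    using LIMSEQ_ignore_initial_segment[OF lim_1_over_n[where 'a = real], of m] by simp
  have "(\<lambda>p. long_run_variance + (w m - 2 * real m * long_run_variance) * (1 / real (p + m)))
      \<longlonglongrightarrow> long_run_variance + (w m - 2 * real m * long_run_variance) * 0"
    by (intro tendsto_intros inv)
  then have "(\<lambda>p. long_run_variance + (w m - 2 * real m * long_run_variance) * (1 / real (p + m)))
      \<longlonglongrightarrow> long_run_variance" by simp
  moreover have "\<forall>\<^sub>F p in sequentially. long_run_variance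
      + (w m - 2 * real m * long_run_variance) * (1 / real (p + m)) = w p / real (p + m)"
    using eventually_gt_at_top[of m]
  proof eventually_elim
    case (elim p)
    then have "w p = w m + (real p - real m) * long_run_variance"
      using w[of "p - m"] by (simp add: of_nat_diff)
    then show ?case using elim by (simp add: field_simps)
  qed
  ultimately show ?thesis unfolding w_def[symmetric] by (rule Lim_transform_eventually)
qed

section \<open>Blocks of length \<open>p\<close> separated by gaps of length
  \<open>m\<close>\<close>

definition blocks :: "nat \<Rightarrow> nat \<Rightarrow> nat set" where
  "blocks p r = (\<Union>b<r. {b * (p + m) + 1..b * (p + m) + p})"

lemma blocks_Suc: "blocks p (Suc r) = blocks p r \<union> {r * (p + m) + 1..r * (p + m) + p}"
  unfolding blocks_def by (auto simp: lessThan_Suc)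

text \<open>The next block starts at \<open>r * (p + m) + 1\<close>, so the second bound is exactly
  the separation by more than \<open>m\<close> that \<open>indep_var_S\<close> asks for.\<close>

lemma blocks_gap:
  assumes "i \<in> blocks p r"
  shows "1 \<le> i" "i + m \<le> r * (p + m)"
proof -
  obtain b where b: "b < r" "i \<in> {b * (p + m) + 1..b * (p + m) + p}"
    using assms unfolding blocks_def by auto
  have "Suc b * (p + m) \<le> r * (p + m)" using b by (intro mult_le_mono1) simp
  then show "1 \<le> i" "i + m \<le> r * (p + m)" using b by auto
qed

lemma finite_blocks: "finite (blocks p r)"
  unfolding blocks_def by auto

lemma card_blocks: "card (blocks p r) = r * p"
proof (induction r)
  case 0
  show ?case by (simp add: blocks_def)
next
  case (Suc r)
  have "blocks p r \<inter> {r * (p + m) + 1..r * (p + m) + p} = {}"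
    using blocks_gap[of _ p r] by fastforce
  then show ?case
    unfolding blocks_Suc by (subst card_Un_disjoint) (auto simp: finite_blocks Suc)
qed

lemma distr_S_shift: "distr M borel (S {s + 1..s + p}) = distr M borel (S {1..p})"
proof -
  have g: "(\<lambda>f. \<Sum>i=1..p. f i - expectation (X 1)) \<in> borel_measurable (Pi\<^sub>M {1..p} (\<lambda>_. borel))"
    by measurable
  have "S {s + 1..s + p} = (\<lambda>\<omega>. \<Sum>i=1..p. Z (i + s) \<omega>)"
    unfolding S_def[abs_def]
    by (intro ext, subst sum.shift_bounds_cl_nat_ivl[symmetric]) (simp add: add.commute)
  then show ?thesis
    using distr_shift[OF _ _ g, of s] by (simp add: S_def[abs_def] Z_def)
qed

text \<open>The last block is independent of the union of all earlier ones and has the law of the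
  first block, so each induction step contributes one factor.\<close>

lemma char_S_blocks:
  "char (distr M borel (S (blocks p r))) t = char (distr M borel (S {1..p})) t ^ r"
proof (induction r)
  case 0
  show ?case by (simp add: blocks_def S_def char_def integral_distr prob_space del: distr_const)
next
  case (Suc r)
  let ?B = "{r * (p + m) + 1..r * (p + m) + p}"
  have disj: "blocks p r \<inter> ?B = {}"
    using blocks_gap[of _ p r] by fastforce
  have "S (blocks p (Suc r)) = (\<lambda>\<omega>. S (blocks p r) \<omega> + S ?B \<omega>)"
    unfolding S_def blocks_Suc using disj by (intro ext sum.union_disjoint) (auto simp: finite_blocks)
  moreover have "indep_var borel (S (blocks p r)) borel (S ?B)"
    using blocks_gap[of _ p r] by (intro indep_var_S) fastforce+
  ultimately show ?case
    using Suc distr_S_shift[of "r * (p + m)" p] by (simp add: char_distr_add)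
qed

lemma expectation_abs_S_le:
  assumes "A \<subseteq> {1..}" "finite A"
  shows "expectation (\<lambda>\<omega>. \<bar>S A \<omega>\<bar>) \<le> sqrt (real (card A) * D)"
  using expectation_abs_le_sqrt[OF S_measurable integrable_S_square] expectation_S_square_le assms
  by (meson order_trans real_sqrt_le_iff)

text \<open>For a fixed block length \<open>p\<close> the blocks are i.i.d., so the limit in \<open>n\<close> is Gaussian with
  variance \<open>E (S {1..p})\<^sup>2 / (p + m)\<close>, up to an error of order \<open>sqrt (m / (p + m))\<close> from the
  discarded gaps; then \<open>p\<close> tends to infinity.\<close>

lemma char_partial_sum_tendsto:
  fixes k :: "nat \<Rightarrow> nat" and u :: "nat \<Rightarrow> real"
  assumes u: "u \<longlonglongrightarrow> 0" and ku: "(\<lambda>n. real (k n) * (u n)\<^sup>2) \<longlonglongrightarrow> c"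
  shows "(\<lambda>n. char (distr M borel (S {1..k n})) (u n))
    \<longlonglongrightarrow> complex_of_real (exp (- (c * long_run_variance / 2)))"
proof -
  \<comment> \<open>One period is a block followed by its gap. The block length \<open>Suc p\<close>
    keeps the period positive even when \<open>p\<close> and \<open>m\<close> are both 0.\<close>
  define q where "q p = Suc p + m" for p
  define r where "r p n = k n div q p" for p n
  define w where "w p = expectation (\<lambda>\<omega>. (S {1..Suc p} \<omega>)\<^sup>2)" for p
  define h where "h p n = char (distr M borel (S (blocks (Suc p) (r p n)))) (u n)" for p n
  \<comment> \<open>This is \<open>\<bar>u n\<bar>\<close> times the square root of \<open>D\<close>
    times a bound on the number of indices outside the blocks.\<close>
  define err where
    "err p n = sqrt (D * ((u n)\<^sup>2 * real (q p) + real (k n) * (u n)\<^sup>2 * real m / real (q p)))" for p n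
  have q: "q p > 0" for p by (simp add: q_def)
  have u2: "(\<lambda>n. (u n)\<^sup>2) \<longlonglongrightarrow> 0" using tendsto_power[OF u, of 2] by simp
  have inv_q: "(\<lambda>p. 1 / real (q p)) \<longlonglongrightarrow> 0"
    using LIMSEQ_ignore_initial_segment[OF lim_1_over_n[where 'a = real], of "Suc m"]
    by (simp add: q_def)
  show ?thesis
  proof (rule tendsto_by_approximation)
    fix p n
    have sub: "blocks (Suc p) (r p n) \<subseteq> {1..k n}"
    proof
      fix i assume "i \<in> blocks (Suc p) (r p n)"
      then have "1 \<le> i" "i + m \<le> r p n * q p" using blocks_gap[of i "Suc p"] by (auto simp: q_def)
      moreover have "r p n * q p \<le> k n" by (simp add: r_def)
      ultimately show "i \<in> {1..k n}" by simp
    qed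
    let ?A = "{1..k n} - blocks (Suc p) (r p n)"
    have diff: "S {1..k n} \<omega> - S (blocks (Suc p) (r p n)) \<omega> = S ?A \<omega>" for \<omega>
      unfolding S_def using sub by (subst sum_diff) auto
    \<comment> \<open>The leftover consists of an incomplete period at the end and one gap of
      \<open>m\<close> indices for each of the \<open>r p n\<close> complete periods.\<close>
    have "real (card ?A) = real (k n) - real (r p n) * real (Suc p)"
      using sub card_mono[OF _ sub] by (simp add: card_Diff_subset finite_blocks card_blocks of_nat_diff algebra_simps)
    also have "real (k n) = real (r p n) * real (q p) + real (k n mod q p)"
      unfolding r_def by (metis div_mult_mod_eq of_nat_add of_nat_mult)
    also have "real (r p n) * real (q p) + real (k n mod q p) - real (r p n) * real (Suc p)
        = real (k n mod q p) + real (r p n) * real m" by (simp add: q_def algebra_simps)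
    also have "\<dots> \<le> real (q p) + real (k n) / real (q p) * real m"
    proof (intro add_mono mult_right_mono)
      show "real (k n mod q p) \<le> real (q p)" using q[of p] by (simp add: less_imp_le)
      show "real (r p n) \<le> real (k n) / real (q p)"
        unfolding r_def by (rule of_nat_div_le_of_nat)
    qed simp
    finally have card: "real (card ?A) \<le> real (q p) + real (k n) / real (q p) * real m" .
    have "dist (char (distr M borel (S {1..k n})) (u n)) (h p n)
        \<le> \<bar>u n\<bar> * expectation (\<lambda>\<omega>. \<bar>S {1..k n} \<omega> - S (blocks (Suc p) (r p n)) \<omega>\<bar>)"
      unfolding h_def
    proof (rule char_distr_dist_le)
      show "integrable M (\<lambda>\<omega>. S {1..k n} \<omega> - S (blocks (Suc p) (r p n)) \<omega>)"
        unfolding diff by (rule integrable_S) auto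
    qed (use sub in \<open>auto intro!: S_measurable\<close>)
    also have "\<dots> = \<bar>u n\<bar> * expectation (\<lambda>\<omega>. \<bar>S ?A \<omega>\<bar>)" unfolding diff ..
    also have "\<dots> \<le> \<bar>u n\<bar> * sqrt (real (card ?A) * D)"
      by (intro mult_left_mono expectation_abs_S_le) auto
    also have "\<dots> \<le> \<bar>u n\<bar> * sqrt ((real (q p) + real (k n) / real (q p) * real m) * D)"
      using card D_nonneg by (intro mult_left_mono real_sqrt_le_mono mult_right_mono) auto
    also have "\<dots> = sqrt ((u n)\<^sup>2 * ((real (q p) + real (k n) / real (q p) * real m) * D))"
      by (simp only: real_sqrt_mult real_sqrt_abs)
    also have "\<dots> = err p n" unfolding err_def by (simp add: algebra_simps)
    finally show "dist (char (distr M borel (S {1..k n})) (u n)) (h p n) \<le> err p n" .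
  next
    fix p
    \<comment> \<open>The remainder stays below the fixed period, so in the limit
      \<open>r p n\<close> may be treated as \<open>k n / q p\<close>.\<close>
    have "(\<lambda>n. (u n)\<^sup>2 * real (k n mod q p)) \<longlonglongrightarrow> 0"
    proof (rule Lim_null_comparison)
      show "\<forall>\<^sub>F n in sequentially. norm ((u n)\<^sup>2 * real (k n mod q p)) \<le> (u n)\<^sup>2 * real (q p)"
        using q[of p] by (intro always_eventually allI) (simp add: mult_left_mono less_imp_le)
      show "(\<lambda>n. (u n)\<^sup>2 * real (q p)) \<longlonglongrightarrow> 0" using tendsto_mult_left_zero[OF u2] .
    qed
    then have "(\<lambda>n. (real (k n) * (u n)\<^sup>2 - (u n)\<^sup>2 * real (k n mod q p)) / real (q p))
        \<longlonglongrightarrow> (c - 0) / real (q p)"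
      using q[of p] by (intro tendsto_intros ku) auto
    moreover have "(real (k n) * (u n)\<^sup>2 - (u n)\<^sup>2 * real (k n mod q p)) / real (q p)
        = real (r p n) * (u n)\<^sup>2" for n
    proof -
      have "real (k n) = real (r p n) * real (q p) + real (k n mod q p)"
        unfolding r_def by (metis div_mult_mod_eq of_nat_add of_nat_mult)
      then show ?thesis using q[of p] by (simp add: field_simps)
    qed
    ultimately have ru: "(\<lambda>n. real (r p n) * (u n)\<^sup>2) \<longlonglongrightarrow> c / real (q p)" by simp
    interpret d: real_distribution "distr M borel (S {1..Suc p})"
      by (rule real_distribution_distr) (auto intro!: S_measurable)
    have S: "S {1..Suc p} \<in> borel_measurable M" by (auto intro!: S_measurable)
    have "(\<lambda>n. char (distr M borel (S {1..Suc p})) (u n) ^ r p n)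
        \<longlonglongrightarrow> complex_of_real (exp (- (c / real (q p) * w p / 2)))"
      using integrable_S[of "{1..Suc p}"] expectation_S[of "{1..Suc p}"] integrable_S_square[of "{1..Suc p}"] S
      by (intro d.char_power_tendsto u ru) (simp_all add: integrable_distr_eq integral_distr w_def)
    then show "h p \<longlonglongrightarrow> complex_of_real (exp (- (c / real (q p) * w p / 2)))"
      by (simp add: h_def[abs_def] char_S_blocks)
    \<comment> \<open>The incomplete period disappears as \<open>n\<close> grows, but the gaps keep
      a fixed proportion \<open>m / q p\<close> of all indices; only letting \<open>p\<close> grow
      removes them.\<close>
    have "(\<lambda>n. err p n) \<longlonglongrightarrow> sqrt (D * (0 * real (q p) + c * real m / real (q p)))"
      unfolding err_def using q[of p] by (intro tendsto_intros ku u2) auto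
    then show "err p \<longlonglongrightarrow> sqrt (D * (c * real m * (1 / real (q p))))" by simp
  next
    \<comment> \<open>The shift by \<open>LIMSEQ_Suc\<close> accounts for the block length
      \<open>Suc p\<close>.\<close>
    have "(\<lambda>p. complex_of_real (exp (- (c * (w p / real (q p)) / 2))))
        \<longlonglongrightarrow> complex_of_real (exp (- (c * long_run_variance / 2)))"
      using LIMSEQ_Suc[OF expectation_S_square_tendsto]
      unfolding w_def q_def by (intro tendsto_intros) auto
    then show "(\<lambda>p. complex_of_real (exp (- (c / real (q p) * w p / 2))))
        \<longlonglongrightarrow> complex_of_real (exp (- (c * long_run_variance / 2)))" by simp
  next
    have "(\<lambda>p. sqrt (D * (c * real m * (1 / real (q p))))) \<longlonglongrightarrow> sqrt (D * (c * real m * 0))"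
      by (intro tendsto_intros inv_q)
    then show "(\<lambda>p. sqrt (D * (c * real m * (1 / real (q p))))) \<longlonglongrightarrow> 0" by simp
  qed
qed

section \<open>Sums up to an independent random index\<close>

lemma S_random_measurable:
  assumes N: "N \<in> measurable M (count_space UNIV)"
  shows "(\<lambda>\<omega>. S {1..N \<omega>} \<omega>) \<in> borel_measurable M"
  by (rule measurable_compose_countable[OF _ N]) (auto intro!: S_measurable)

text \<open>Up to sign the difference is a sum over \<open>\<bar>l - k\<bar>\<close>
  indices.\<close>

lemma expectation_S_diff_square_le:
  "expectation (\<lambda>\<omega>. (S {1..l} \<omega> - S {1..k} \<omega>)\<^sup>2) \<le> D * \<bar>real l - real k\<bar>"
proof -
  have *: "expectation (\<lambda>\<omega>. (S {1..l} \<omega> - S {1..k} \<omega>)\<^sup>2) \<le> D * \<bar>real l - real k\<bar>" if "k \<le> l" for k l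
  proof -
    have "S {1..l} \<omega> - S {1..k} \<omega> = S ({1..l} - {1..k}) \<omega>" for \<omega>
      unfolding S_def using that by (subst sum_diff) auto
    moreover have "card ({1..l} - {1..k}) = l - k" using that by (subst card_Diff_subset) auto
    ultimately show ?thesis
      using expectation_S_square_le[of "{1..l} - {1..k}"] that
      by (simp add: mult.commute of_nat_diff subset_eq)
  qed
  show ?thesis
  proof (cases "k \<le> l")
    case False
    then show ?thesis using *[of l k] by (simp add: power2_commute abs_minus_commute)
  qed (rule *)
qed

text \<open>Independence permits freezing the index and applying the deterministic bound for each
  value. Working with nonnegative integrals first makes integrability a consequence of the finite
  bound. The index is a function of a general \<open>U\<close> so that independence from a whole
  sequence can be used directly.\<close>

lemma random_index_second_moment:
  fixes N :: "'a \<Rightarrow> nat" and U :: "'a \<Rightarrow> nat \<Rightarrow> real"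
  assumes indep: "indep_var (Pi\<^sub>M {1..} (\<lambda>_. borel)) (\<lambda>\<omega>. \<lambda>i\<in>{1..}. X i \<omega>) Q U"
    and \<phi>: "\<phi> \<in> measurable Q (count_space UNIV)" and N: "N = (\<lambda>\<omega>. \<phi> (U \<omega>))"
    and int: "integrable M (\<lambda>\<omega>. real (N \<omega>))"
  shows "integrable M (\<lambda>\<omega>. (S {1..N \<omega>} \<omega> - S {1..k} \<omega>)\<^sup>2)"
    and "expectation (\<lambda>\<omega>. (S {1..N \<omega>} \<omega> - S {1..k} \<omega>)\<^sup>2) \<le> D * expectation (\<lambda>\<omega>. \<bar>real (N \<omega>) - real k\<bar>)"
proof -
  let ?P = "Pi\<^sub>M {1..} (\<lambda>_. borel) :: (nat \<Rightarrow> real) measure"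
  let ?C = "count_space UNIV :: nat measure"
  let ?X = "\<lambda>\<omega>. \<lambda>i\<in>{1..}. X i \<omega>"
  have rv [measurable]: "?X \<in> measurable M ?P" "U \<in> measurable M Q"
    using indep_var_rv1[OF indep] indep_var_rv2[OF indep] .
  note \<phi> [measurable]
  have N_measurable [measurable]: "N \<in> measurable M ?C" unfolding N by measurable
  have [measurable]: "(\<lambda>\<omega>. S {1..N \<omega>} \<omega>) \<in> borel_measurable M"
    by (rule S_random_measurable) (rule N_measurable)
  have [measurable]: "S {1..l} \<in> borel_measurable M" for l by (auto intro!: S_measurable)
  define c where "c = expectation (X 1)"
  define f where "f z = ennreal (((\<Sum>i=1..snd z. fst z i - c) - (\<Sum>i=1..k. fst z i - c))\<^sup>2)"
    for z :: "(nat \<Rightarrow> real) \<times> nat"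
  have [measurable]: "(\<lambda>x. \<Sum>i=1..l. x i - c) \<in> borel_measurable ?P" for l
    by measurable
  have f_section: "(\<lambda>x. f (x, l)) \<in> borel_measurable ?P" for l
    unfolding f_def fst_conv snd_conv by measurable
  \<comment> \<open>The index takes countably many values, so measurable sections give joint
    measurability.\<close>
  have [measurable]: "f \<in> borel_measurable (?P \<Otimes>\<^sub>M ?C)"
    using measurable_compose_countable[of "\<lambda>l z. f (fst z, l)",
        OF measurable_compose[OF measurable_fst f_section] measurable_snd] by simp
  have f: "(\<lambda>(x, v). f (x, \<phi> v)) \<in> borel_measurable (?P \<Otimes>\<^sub>M Q)"
    by measurable
  have f_X: "f (?X \<omega>, l) = ennreal ((S {1..l} \<omega> - S {1..k} \<omega>)\<^sup>2)" for \<omega> l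
    by (simp add: f_def S_def Z_def c_def)
  interpret DX: prob_space "distr M ?P ?X" by (rule prob_space_distr) (rule rv)
  interpret DU: prob_space "distr M Q U" by (rule prob_space_distr) (rule rv)
  interpret pair_sigma_finite "distr M ?P ?X" "distr M Q U" ..
  have "(\<integral>\<^sup>+\<omega>. ennreal ((S {1..N \<omega>} \<omega> - S {1..k} \<omega>)\<^sup>2) \<partial>M) = (\<integral>\<^sup>+\<omega>. f (?X \<omega>, \<phi> (U \<omega>)) \<partial>M)"
    unfolding f_X N ..
  also have "\<dots> = (\<integral>\<^sup>+(x, v). f (x, \<phi> v) \<partial>distr M (?P \<Otimes>\<^sub>M Q) (\<lambda>\<omega>. (?X \<omega>, U \<omega>)))"
    using nn_integral_distr[OF measurable_Pair[OF rv], of "\<lambda>(x, v). f (x, \<phi> v)"] f by simp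
  \<comment> \<open>The joint law is a product, and Tonelli's theorem makes the integral over the
    path of \<open>X\<close> the inner one.\<close>
  also have "\<dots> = (\<integral>\<^sup>+(x, v). f (x, \<phi> v) \<partial>(distr M ?P ?X \<Otimes>\<^sub>M distr M Q U))"
    using indep by (simp add: indep_var_distribution_eq)
  also have "\<dots> = (\<integral>\<^sup>+v. \<integral>\<^sup>+x. f (x, \<phi> v) \<partial>distr M ?P ?X \<partial>distr M Q U)"
    using nn_integral_snd[of "\<lambda>(x, v). f (x, \<phi> v)"] f by simp
  also have "\<dots> \<le> (\<integral>\<^sup>+v. ennreal (D * \<bar>real (\<phi> v) - real k\<bar>) \<partial>distr M Q U)"
  proof (rule nn_integral_mono)
    fix v
    define l where "l = \<phi> v"
    have "integrable M (\<lambda>\<omega>. (S {1..l} \<omega> - S {1..k} \<omega>)\<^sup>2)"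
    proof (rule Bochner_Integration.integrable_bound)
      show "integrable M (\<lambda>\<omega>. 2 * ((S {1..l} \<omega>)\<^sup>2 + (S {1..k} \<omega>)\<^sup>2))"
        using integrable_S_square[of "{1..l}"] integrable_S_square[of "{1..k}"] by auto
      have "(x - y)\<^sup>2 \<le> 2 * (x\<^sup>2 + y\<^sup>2)" for x y :: real
        using sum_squares_bound[of x "- y"] by (simp add: power2_diff)
      then show "AE \<omega> in M. norm ((S {1..l} \<omega> - S {1..k} \<omega>)\<^sup>2)
          \<le> norm (2 * ((S {1..l} \<omega>)\<^sup>2 + (S {1..k} \<omega>)\<^sup>2))"
        by (intro AE_I2) simp
    qed measurable
    then have "(\<integral>\<^sup>+\<omega>. ennreal ((S {1..l} \<omega> - S {1..k} \<omega>)\<^sup>2) \<partial>M)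
        = ennreal (expectation (\<lambda>\<omega>. (S {1..l} \<omega> - S {1..k} \<omega>)\<^sup>2))"
      by (intro nn_integral_eq_integral) auto
    also have "\<dots> \<le> ennreal (D * \<bar>real l - real k\<bar>)"
      using expectation_S_diff_square_le by (rule ennreal_leI)
    finally show "(\<integral>\<^sup>+x. f (x, \<phi> v) \<partial>distr M ?P ?X) \<le> ennreal (D * \<bar>real (\<phi> v) - real k\<bar>)"
      unfolding l_def[symmetric] f_X[symmetric]
      using nn_integral_distr[OF rv(1), of "\<lambda>x. f (x, l)"] f_section[of l] by simp
  qed
  also have "\<dots> = (\<integral>\<^sup>+\<omega>. ennreal (D * \<bar>real (N \<omega>) - real k\<bar>) \<partial>M)"
    unfolding N by (subst nn_integral_distr) auto
  also have "\<dots> = ennreal (D * expectation (\<lambda>\<omega>. \<bar>real (N \<omega>) - real k\<bar>))"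
    using int D_nonneg by (subst nn_integral_eq_integral) auto
  finally have le: "(\<integral>\<^sup>+\<omega>. ennreal ((S {1..N \<omega>} \<omega> - S {1..k} \<omega>)\<^sup>2) \<partial>M)
      \<le> ennreal (D * expectation (\<lambda>\<omega>. \<bar>real (N \<omega>) - real k\<bar>))" .
  then show I: "integrable M (\<lambda>\<omega>. (S {1..N \<omega>} \<omega> - S {1..k} \<omega>)\<^sup>2)"
  proof (intro integrableI_nonneg)
    show "(\<lambda>\<omega>. (S {1..N \<omega>} \<omega> - S {1..k} \<omega>)\<^sup>2) \<in> borel_measurable M" by measurable
  qed (auto intro: le_less_trans)
  then show "expectation (\<lambda>\<omega>. (S {1..N \<omega>} \<omega> - S {1..k} \<omega>)\<^sup>2) \<le> D * expectation (\<lambda>\<omega>. \<bar>real (N \<omega>) - real k\<bar>)"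
    using le D_nonneg by (subst (asm) nn_integral_eq_integral) (auto simp: ennreal_le_iff)
qed

end

section \<open>The central limit theorem for the random sum\<close>

theorem theorem2p3:
  fixes M :: "'a measure" and m :: nat
    and X :: "nat \<Rightarrow> 'a \<Rightarrow> real" and Y :: "nat \<Rightarrow> 'a \<Rightarrow> nat"
    and \<mu> \<sigma>2 \<nu> \<tau>2 :: real and a :: "nat \<Rightarrow> real"
  assumes P: "prob_space M"
    and X_meas: "\<And>i. i \<ge> 1 \<Longrightarrow> X i \<in> borel_measurable M"
    and X_nonneg: "\<And>i \<omega>. i \<ge> 1 \<Longrightarrow> \<omega> \<in> space M \<Longrightarrow> X i \<omega> \<ge> 0"
    and X_stat: "stationary_seq M X"
    and X_mdep: "m_dependent M m X"
    and X_int3: "integrable M (\<lambda>\<omega>. \<bar>X 1 \<omega>\<bar> ^ 3)"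
    and mu_def: "\<mu> = prob_space.expectation M (X 1)" and mu_pos: "\<mu> > 0"
    and sigma_def: "\<sigma>2 = prob_space.variance M (X 1)" and sigma_pos: "\<sigma>2 > 0"
    and a_def: "\<And>j. a j = cov M (X 1) (X (1 + j))"
    and sum_pos: "\<sigma>2 + 2 * (\<Sum>j=1..m. a j) > 0"
    and Y_meas: "\<And>i. i \<ge> 1 \<Longrightarrow> Y i \<in> measurable M (count_space UNIV)"
    and Y_indep: "prob_space.indep_vars M (\<lambda>_. count_space UNIV) Y {1..}"
    and Y_ident: "\<And>i. i \<ge> 1 \<Longrightarrow> distr M (count_space UNIV) (Y i) = distr M (count_space UNIV) (Y 1)"
    and Y_int3: "integrable M (\<lambda>\<omega>. \<bar>real (Y 1 \<omega>)\<bar> ^ 3)"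
    and nu_def: "\<nu> = prob_space.expectation M (\<lambda>\<omega>. real (Y 1 \<omega>))" and nu_pos: "\<nu> > 0"
    and tau_def: "\<tau>2 = prob_space.variance M (\<lambda>\<omega>. real (Y 1 \<omega>))" and tau_pos: "\<tau>2 > 0"
    and XY_indep: "prob_space.indep_var M
        (Pi\<^sub>M {1..} (\<lambda>_. borel)) (\<lambda>\<omega>. \<lambda>i\<in>{1..}. X i \<omega>)
        (Pi\<^sub>M {1..} (\<lambda>_. borel)) (\<lambda>\<omega>. \<lambda>i\<in>{1..}. real (Y i \<omega>))"
  shows "weak_conv_m
     (\<lambda>n. distr M borel (\<lambda>\<omega>.
        ((\<Sum>i=1..(\<Sum>k=1..n. Y k \<omega>). X i \<omega>) - real n * \<mu> * \<nu>)
        / sqrt (real n * (\<nu> * \<sigma>2 + 2 * \<nu> * (\<Sum>j=1..m. a j) + \<tau>2 * \<mu>\<^sup>2))))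
     std_normal_distribution"
proof -
  interpret prob_space M by (rule P)
  \<comment> \<open>Third moments dominate second moments through
    \<open>x\<^sup>2 \<le> 1 + \<bar>x\<bar> ^ 3\<close>.\<close>
  have square_integrable: "integrable M (\<lambda>\<omega>. (V \<omega>)\<^sup>2)"
    if [measurable]: "V \<in> borel_measurable M" and "integrable M (\<lambda>\<omega>. \<bar>V \<omega>\<bar> ^ 3)" for V :: "'a \<Rightarrow> real"
  proof (rule Bochner_Integration.integrable_bound)
    show "integrable M (\<lambda>\<omega>. 1 + \<bar>V \<omega>\<bar> ^ 3)" using that by simp
    have "x\<^sup>2 \<le> 1 + \<bar>x\<bar> ^ 3" for x :: real
    proof (cases "\<bar>x\<bar> \<le> 1")
      case True
      then have "x\<^sup>2 \<le> 1" by (simp add: abs_square_le_1)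
      then show ?thesis by (simp add: add_increasing2)
    next
      case False
      then have "\<bar>x\<bar>\<^sup>2 \<le> \<bar>x\<bar> ^ 3" by (intro power_increasing) auto
      then show ?thesis by simp
    qed
    then show "AE \<omega> in M. norm ((V \<omega>)\<^sup>2) \<le> norm (1 + \<bar>V \<omega>\<bar> ^ 3)" by (intro AE_I2) simp
  qed measurable
  interpret stationary_m_dependent M m X
    using X_meas X_stat X_mdep square_integrable[OF _ X_int3] by unfold_locales auto
  define s2 where "s2 = \<nu> * \<sigma>2 + 2 * \<nu> * (\<Sum>j=1..m. a j) + \<tau>2 * \<mu>\<^sup>2"
  \<comment> \<open>The first term is the variance from summing about \<open>n * \<nu>\<close> of
    the \<open>X i\<close>, the second the variance from the fluctuating number of summands, both
    per unit of \<open>n\<close>.\<close>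
  have s2: "s2 = \<nu> * long_run_variance + \<tau>2 * \<mu>\<^sup>2"
    by (simp add: s2_def long_run_variance_def autocov_def a_def sigma_def distrib_left)
  have "\<nu> * (\<sigma>2 + 2 * (\<Sum>j=1..m. a j)) > 0" using nu_pos sum_pos by simp
  then have s2_pos: "s2 > 0"
    using tau_pos by (simp add: s2_def distrib_left add_pos_nonneg mult.assoc)
  define N where "N n \<omega> = (\<Sum>k=1..n. Y k \<omega>)" for n \<omega>
  define V where "V i \<omega> = real (Y i \<omega>) - \<nu>" for i \<omega>
  define W where "W n \<omega> = (\<Sum>i=1..n. V i \<omega>)" for n \<omega>
  have N_W: "real (N n \<omega>) = W n \<omega> + real n * \<nu>" for n \<omega>
    by (simp add: N_def W_def V_def sum_subtractf)
  have V_measurable: "V i \<in> borel_measurable M" if "i \<ge> 1" for i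
    unfolding V_def using Y_meas[OF that] by measurable
  have W_measurable [measurable]: "W n \<in> borel_measurable M" for n
    unfolding W_def using V_measurable by (intro borel_measurable_sum) auto
  have N_measurable [measurable]: "N n \<in> measurable M (count_space UNIV)" for n
    unfolding N_def using Y_meas by (intro measurable_sum_nat) auto
  have V_distr: "distr M borel (V i) = distr M borel (V 1)" if "i \<ge> 1" for i
  proof -
    have "distr M borel (V i) = distr (distr M (count_space UNIV) (Y i)) borel (\<lambda>y. real y - \<nu>)"
      if "i \<ge> 1" for i
      using Y_meas[OF that] by (subst distr_distr) (auto simp: comp_def V_def[abs_def])
    from this[OF that] this[of 1] show ?thesis using Y_ident[OF that] by simp
  qed
  have Y1 [measurable]: "(\<lambda>\<omega>. real (Y 1 \<omega>)) \<in> borel_measurable M" using Y_meas[of 1] by measurable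
  have Y1_sq: "integrable M (\<lambda>\<omega>. (real (Y 1 \<omega>))\<^sup>2)" by (rule square_integrable[OF Y1 Y_int3])
  have Y1_int: "integrable M (\<lambda>\<omega>. real (Y 1 \<omega>))"
    using square_integrable_imp_integrable[OF Y1] Y1_sq by simp
  have V1: "integrable M (V 1)" "expectation (V 1) = 0" "integrable M (\<lambda>\<omega>. (V 1 \<omega>)\<^sup>2)"
    "expectation (\<lambda>\<omega>. (V 1 \<omega>)\<^sup>2) = \<tau>2"
    unfolding V_def using Y1_int Y1_sq
    by (simp_all add: nu_def tau_def prob_space power2_diff del: of_nat_power)
  have V_moments: "expectation (V i) = 0" "integrable M (\<lambda>\<omega>. (V i \<omega>)\<^sup>2)"
      "expectation (\<lambda>\<omega>. (V i \<omega>)\<^sup>2) = \<tau>2" if "i \<ge> 1" for i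
  proof -
    have "expectation (V j) = (\<integral>x. x \<partial>distr M borel (V j))"
      "integrable M (\<lambda>\<omega>. (V j \<omega>)\<^sup>2) \<longleftrightarrow> integrable (distr M borel (V j)) (\<lambda>x. x\<^sup>2)"
      "expectation (\<lambda>\<omega>. (V j \<omega>)\<^sup>2) = (\<integral>x. x\<^sup>2 \<partial>distr M borel (V j))" if "j \<ge> 1" for j
      using V_measurable[OF that] by (simp_all add: integral_distr integrable_distr_eq)
    from this[OF that] this[of 1] show "expectation (V i) = 0" "integrable M (\<lambda>\<omega>. (V i \<omega>)\<^sup>2)"
      "expectation (\<lambda>\<omega>. (V i \<omega>)\<^sup>2) = \<tau>2"
      using V1 V_distr[OF that] by simp_all
  qed
  have V_indep: "indep_vars (\<lambda>_. borel) V {1..n}" for n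
    unfolding V_def[abs_def]
    by (rule indep_vars_compose2[OF indep_vars_subset[OF Y_indep]]) auto
  have W_sq: "integrable M (\<lambda>\<omega>. (W n \<omega>)\<^sup>2)" "expectation (\<lambda>\<omega>. (W n \<omega>)\<^sup>2) = real n * \<tau>2" for n
    using expectation_indep_sum_square[OF _ V_indep[of n]] V_moments by (simp_all add: W_def)
  have W_int: "integrable M (W n)" for n
    using square_integrable_imp_integrable[OF W_measurable W_sq(1)] .
  have char_W: "char (distr M borel (W n)) t = char (distr M borel (V 1)) t ^ n" for n t
  proof -
    have "char (distr M borel (W n)) t = (\<Prod>i=1..n. char (distr M borel (V i)) t)"
      unfolding W_def by (rule char_distr_sum[OF V_indep])
    also have "\<dots> = (\<Prod>i=1..n. char (distr M borel (V 1)) t)"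
      by (intro prod.cong refl) (metis V_distr atLeastAtMost_iff)
    finally show ?thesis by simp
  qed
  have int_N: "integrable M (\<lambda>\<omega>. real (N n \<omega>))" for n
    unfolding N_W using W_int by simp
  have S_N_measurable [measurable]: "(\<lambda>\<omega>. S {1..N n \<omega>} \<omega>) \<in> borel_measurable M" for n
    by (rule S_random_measurable) simp
  have S_measurable' [measurable]: "S {1..l} \<in> borel_measurable M" for l by (auto intro!: S_measurable)
  \<comment> \<open>\<open>XY_indep\<close> concerns the real-valued copies of \<open>Y\<close>, so
    \<open>N n\<close> has to be a function of those. Their sum is a natural number, which
    \<open>nat\<close> of the floor recovers exactly.\<close>
  have floor_measurable: "(\<lambda>f. nat \<lfloor>\<Sum>i=1..n. f i\<rfloor>)
      \<in> measurable (Pi\<^sub>M {1..} (\<lambda>_. borel :: real measure)) (count_space UNIV)" for n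
    by measurable
  have N_floor: "N n = (\<lambda>\<omega>. nat \<lfloor>\<Sum>i=1..n. (\<lambda>i\<in>{1..}. real (Y i \<omega>)) i\<rfloor>)" for n
    by (simp add: N_def[abs_def] flip: of_nat_sum)
  \<comment> \<open>At a deterministic index the first sum is a function of \<open>X\<close> alone
    and the second of \<open>Y\<close> alone.\<close>
  have indep_S_W: "indep_var borel (S {1..l}) borel (\<lambda>\<omega>. \<mu> * W n \<omega>)" for l n
  proof -
    have g: "(\<lambda>f. \<Sum>i=1..l. f i - expectation (X 1)) \<in> borel_measurable (Pi\<^sub>M {1..} (\<lambda>_. borel))"
      "(\<lambda>f. \<mu> * (\<Sum>i=1..n. f i - \<nu>)) \<in> borel_measurable (Pi\<^sub>M {1..} (\<lambda>_. borel))"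
      by measurable
    from indep_var_compose[OF XY_indep g] show ?thesis
      by (simp add: comp_def S_def[abs_def] Z_def W_def V_def)
  qed
  \<comment> \<open>The floor is nonnegative because \<open>\<nu>\<close> is positive, so
    \<open>nat\<close> changes nothing and \<open>k n\<close> is within 1 of
    \<open>n * \<nu>\<close>.\<close>
  define k where "k n = nat \<lfloor>real n * \<nu>\<rfloor>" for n
  have k: "\<bar>real n * \<nu> - real (k n)\<bar> \<le> 1" for n
  proof -
    have "real (k n) = of_int \<lfloor>real n * \<nu>\<rfloor>" using nu_pos by (simp add: k_def)
    then show ?thesis by linarith
  qed
  have E_abs_N: "expectation (\<lambda>\<omega>. \<bar>real (N n \<omega>) - real (k n)\<bar>) \<le> sqrt (real n * \<tau>2) + 1" for n
  proof -
    have "expectation (\<lambda>\<omega>. \<bar>real (N n \<omega>) - real (k n)\<bar>) \<le> expectation (\<lambda>\<omega>. \<bar>W n \<omega>\<bar> + 1)"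
    proof (rule integral_mono)
      show "\<bar>real (N n \<omega>) - real (k n)\<bar> \<le> \<bar>W n \<omega>\<bar> + 1" for \<omega>
        using k[of n] unfolding N_W by linarith
    qed (use int_N W_int in auto)
    also have "\<dots> = expectation (\<lambda>\<omega>. \<bar>W n \<omega>\<bar>) + 1" using W_int by (simp add: prob_space)
    also have "expectation (\<lambda>\<omega>. \<bar>W n \<omega>\<bar>) \<le> sqrt (real n * \<tau>2)"
      using expectation_abs_le_sqrt[OF W_measurable W_sq(1)] W_sq(2) by simp
    finally show ?thesis by simp
  qed
  define T where "T n \<omega> = S {1..N n \<omega>} \<omega> + \<mu> * W n \<omega>" for n \<omega>
  have T_measurable [measurable]: "T n \<in> borel_measurable M" for n unfolding T_def by measurable
  have T: "(\<Sum>i=1..(\<Sum>k=1..n. Y k \<omega>). X i \<omega>) - real n * \<mu> * \<nu> = T n \<omega>" for n \<omega>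
  proof -
    have "T n \<omega> = (\<Sum>i=1..N n \<omega>. X i \<omega>) - real (N n \<omega>) * \<mu> + \<mu> * W n \<omega>"
      by (simp add: T_def S_def Z_def sum_subtractf mu_def)
    then show ?thesis unfolding N_def[symmetric] by (simp add: N_W algebra_simps)
  qed
  show ?thesis
    unfolding T s2_def[symmetric]
  proof (rule levy_continuity)
    fix t :: real
    \<comment> \<open>Normalising \<open>T n\<close> amounts to evaluating its characteristic
      function at \<open>u n\<close> instead of \<open>t\<close>. At \<open>n = 0\<close> the
      quotient is 0, hence the restriction in \<open>nu2\<close>.\<close>
    define u where "u n = t / sqrt (real n * s2)" for n
    have nu2: "real n * (u n)\<^sup>2 = t\<^sup>2 / s2" if "n > 0" for n
      using that s2_pos by (simp add: u_def power_divide)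
    have u0: "u \<longlonglongrightarrow> 0"
      unfolding u_def using s2_pos by real_asymp
    have nu_lim: "(\<lambda>n. real n * (u n)\<^sup>2) \<longlonglongrightarrow> t\<^sup>2 / s2"
      using nu2 by (intro tendsto_eventually eventually_mono[OF eventually_gt_at_top[of 0]]) auto
    have u2: "(\<lambda>n. (u n)\<^sup>2) \<longlonglongrightarrow> 0" using tendsto_power[OF u0, of 2] by simp
    \<comment> \<open>Rounding \<open>n * \<nu>\<close> to \<open>k n\<close> costs at most
      \<open>(u n)\<^sup>2\<close>.\<close>
    have "(\<lambda>n. (real n * \<nu> - real (k n)) * (u n)\<^sup>2) \<longlonglongrightarrow> 0"
    proof (rule Lim_null_comparison[OF _ u2])
      show "\<forall>\<^sub>F n in sequentially. norm ((real n * \<nu> - real (k n)) * (u n)\<^sup>2) \<le> (u n)\<^sup>2"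
        using k by (intro always_eventually allI) (auto simp: abs_mult intro!: mult_left_le_one_le)
    qed
    from tendsto_diff[OF tendsto_mult_left[OF nu_lim, of \<nu>] this]
    have ku: "(\<lambda>n. real (k n) * (u n)\<^sup>2) \<longlonglongrightarrow> \<nu> * (t\<^sup>2 / s2)"
      by (simp add: algebra_simps)
    have lim_S: "(\<lambda>n. char (distr M borel (S {1..k n})) (u n))
        \<longlonglongrightarrow> complex_of_real (exp (- (\<nu> * (t\<^sup>2 / s2) * long_run_variance / 2)))"
      by (rule char_partial_sum_tendsto[OF u0 ku])
    interpret d: real_distribution "distr M borel (V 1)"
      by (rule real_distribution_distr) (simp add: V_measurable)
    have "(\<lambda>n. \<mu>\<^sup>2 * (real n * (u n)\<^sup>2)) \<longlonglongrightarrow> \<mu>\<^sup>2 * (t\<^sup>2 / s2)"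
      by (intro tendsto_intros nu_lim)
    then have "(\<lambda>n. real n * (u n * \<mu>)\<^sup>2) \<longlonglongrightarrow> \<mu>\<^sup>2 * (t\<^sup>2 / s2)"
      by (simp add: power_mult_distrib mult_ac)
    moreover have "(\<lambda>n. u n * \<mu>) \<longlonglongrightarrow> 0" using tendsto_mult_left_zero[OF u0] .
    ultimately have lim_W: "(\<lambda>n. char (distr M borel (V 1)) (u n * \<mu>) ^ n)
        \<longlonglongrightarrow> complex_of_real (exp (- (\<mu>\<^sup>2 * (t\<^sup>2 / s2) * \<tau>2 / 2)))"
      using V1 V_measurable[of 1]
      by (intro d.char_power_tendsto) (simp_all add: integrable_distr_eq integral_distr)
    \<comment> \<open>This is the characteristic function after the random index is replaced; it
      factors by \<open>indep_S_W\<close>.\<close>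
    define h where "h n = char (distr M borel (\<lambda>\<omega>. S {1..k n} \<omega> + \<mu> * W n \<omega>)) (u n)" for n
    have h_eq: "h n = char (distr M borel (S {1..k n})) (u n) * char (distr M borel (V 1)) (u n * \<mu>) ^ n" for n
    proof -
      have "char (distr M borel (\<lambda>\<omega>. \<mu> * W n \<omega>)) (u n) = char (distr M borel (W n)) (u n * \<mu>)"
        by (simp add: char_def integral_distr mult.assoc)
      then show ?thesis
        unfolding h_def by (subst char_distr_add[OF indep_S_W]) (simp add: char_W)
    qed
    have h_lim: "h \<longlonglongrightarrow> char std_normal_distribution t"
    proof -
      have "(\<lambda>n. h n) \<longlonglongrightarrow> complex_of_real (exp (- (\<nu> * (t\<^sup>2 / s2) * long_run_variance / 2)))
          * complex_of_real (exp (- (\<mu>\<^sup>2 * (t\<^sup>2 / s2) * \<tau>2 / 2)))"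
        unfolding h_eq by (intro tendsto_mult lim_S lim_W)
      \<comment> \<open>The exponents add up to \<open>- (t\<^sup>2 / 2)\<close> because
        \<open>s2\<close> is the sum of the two variances.\<close>
      also have "complex_of_real (exp (- (\<nu> * (t\<^sup>2 / s2) * long_run_variance / 2)))
          * complex_of_real (exp (- (\<mu>\<^sup>2 * (t\<^sup>2 / s2) * \<tau>2 / 2)))
          = complex_of_real (exp (- (t\<^sup>2 / s2 * (\<nu> * long_run_variance + \<tau>2 * \<mu>\<^sup>2) / 2)))"
        by (simp only: of_real_mult[symmetric] exp_add[symmetric]) (simp add: algebra_simps add_divide_distrib)
      also have "\<dots> = char std_normal_distribution t"
        unfolding s2[symmetric] using s2_pos by (simp add: char_std_normal_distribution)
      finally show ?thesis .
    qed
    \<comment> \<open>The \<open>L\<^sup>1\<close> distance is at most the square root of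
      \<open>D\<close> times the mean displacement of \<open>N n\<close> from \<open>k n\<close>,
      which \<open>E_abs_N\<close> bounds. As \<open>(u n)\<^sup>2\<close> is
      \<open>O(1 / n)\<close>, the whole bound is \<open>O(n powr (- 1/4))\<close>.\<close>
    have dist_le: "dist (char (distr M borel (T n)) (u n)) (h n)
        \<le> sqrt (D * ((u n)\<^sup>2 * sqrt (real n * \<tau>2) + (u n)\<^sup>2))" for n
    proof -
      note second = random_index_second_moment[OF XY_indep floor_measurable N_floor int_N, of n "k n"]
      have diff_int: "integrable M (\<lambda>\<omega>. S {1..N n \<omega>} \<omega> - S {1..k n} \<omega>)"
        by (rule square_integrable_imp_integrable[OF _ second(1)]) measurable
      have "dist (char (distr M borel (T n)) (u n)) (h n)
          \<le> \<bar>u n\<bar> * expectation (\<lambda>\<omega>. \<bar>T n \<omega> - (S {1..k n} \<omega> + \<mu> * W n \<omega>)\<bar>)"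
        unfolding h_def
      proof (rule char_distr_dist_le)
        show "(\<lambda>\<omega>. S {1..k n} \<omega> + \<mu> * W n \<omega>) \<in> borel_measurable M" by measurable
      qed (use diff_int in \<open>simp_all add: T_def\<close>)
      also have "\<dots> = \<bar>u n\<bar> * expectation (\<lambda>\<omega>. \<bar>S {1..N n \<omega>} \<omega> - S {1..k n} \<omega>\<bar>)"
        by (simp add: T_def)
      also have "\<dots> \<le> \<bar>u n\<bar> * sqrt (D * (sqrt (real n * \<tau>2) + 1))"
      proof (intro mult_left_mono)
        have "expectation (\<lambda>\<omega>. \<bar>S {1..N n \<omega>} \<omega> - S {1..k n} \<omega>\<bar>)
            \<le> sqrt (expectation (\<lambda>\<omega>. (S {1..N n \<omega>} \<omega> - S {1..k n} \<omega>)\<^sup>2))"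
          by (rule expectation_abs_le_sqrt[OF _ second(1)]) measurable
        also have "\<dots> \<le> sqrt (D * (sqrt (real n * \<tau>2) + 1))"
          using second(2) mult_left_mono[OF E_abs_N[of n] D_nonneg] by simp
        finally show "expectation (\<lambda>\<omega>. \<bar>S {1..N n \<omega>} \<omega> - S {1..k n} \<omega>\<bar>)
            \<le> sqrt (D * (sqrt (real n * \<tau>2) + 1))" .
      qed simp
      also have "\<dots> = sqrt ((u n)\<^sup>2 * (D * (sqrt (real n * \<tau>2) + 1)))"
        by (simp only: real_sqrt_mult real_sqrt_abs)
      also have "(u n)\<^sup>2 * (D * (sqrt (real n * \<tau>2) + 1)) = D * ((u n)\<^sup>2 * sqrt (real n * \<tau>2) + (u n)\<^sup>2)"
        by (simp add: algebra_simps)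
      finally show ?thesis .
    qed
    have "(\<lambda>n. t\<^sup>2 / (real n * s2) * sqrt (real n * \<tau>2)) \<longlonglongrightarrow> 0"
      using s2_pos tau_pos by real_asymp
    moreover have "(u n)\<^sup>2 = t\<^sup>2 / (real n * s2)" for n
      using s2_pos by (simp add: u_def power_divide)
    ultimately have "(\<lambda>n. (u n)\<^sup>2 * sqrt (real n * \<tau>2)) \<longlonglongrightarrow> 0" by simp
    then have "(\<lambda>n. sqrt (D * ((u n)\<^sup>2 * sqrt (real n * \<tau>2) + (u n)\<^sup>2))) \<longlonglongrightarrow> sqrt (D * (0 + 0))"
      by (intro tendsto_intros u2)
    then have err: "(\<lambda>n. sqrt (D * ((u n)\<^sup>2 * sqrt (real n * \<tau>2) + (u n)\<^sup>2))) \<longlonglongrightarrow> 0" by simp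
    \<comment> \<open>Here the approximants do not depend on the outer parameter, so both outer
      limits are of constants.\<close>
    have "(\<lambda>n. char (distr M borel (T n)) (u n)) \<longlonglongrightarrow> char std_normal_distribution t"
      by (rule tendsto_by_approximation[OF dist_le h_lim err tendsto_const tendsto_const])
    moreover have "char (distr M borel (\<lambda>\<omega>. T n \<omega> / sqrt (real n * s2))) t = char (distr M borel (T n)) (u n)" for n
      by (simp add: char_def integral_distr u_def)
    ultimately show "(\<lambda>n. char (distr M borel (\<lambda>\<omega>. T n \<omega> / sqrt (real n * s2))) t)
        \<longlonglongrightarrow> char std_normal_distribution t" by simp
  qed (auto intro!: real_dist_normal_dist)
qed

end
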